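(* Let $\mathbb{A}$ be a unital $C^*$-algebra, let $(X,\mathbb{A},d)$ be a complete $C^*$-algebra valued metric space, let $\varphi: X\to\mathbb{A}_+$ be a function, let $F\in\mathcal{F}$, and let $T:X\to X$. Suppose that: (a) $\varphi$ is lower semi-continuous; (b) there are real numbers $\alpha,\beta,\gamma\in[0,\infty)$ with $\alpha+\beta+\gamma<1$ such that for all $x,y\in X$ $$F(d(Tx,Ty),\varphi(Tx),\varphi(Ty))\preceq \alpha F(d(x,y),\varphi(x),\varphi(y))+\beta F(d(x,Tx),\varphi(x),\varphi(Tx))+\gamma F(d(y,Ty),\varphi(y),\varphi(Ty)).$$ Then: (i) $F_T\subseteq Z_\varphi$; (ii) $T$ is a $\varphi$-Picard operator.
   Context: $\mathbb{A}$ is a unital $C^*$-algebra with zero element $\theta$; $\mathbb{A}_+$ is the set of positive elements (self-adjoint with spectrum in $[0,\infty)$), and for self-adjoint $a,b$, $a\preceq b$ means $b-a\in\mathbb{A}_+$. A $C^*$-algebra valued metric space $(X,\mathbb{A},d)$ is a non-empty set $X$ with $d:X\times X\to\mathbb{A}$ such that for all $x,y,z$: $\theta\preceq d(x,y)$, with $d(x,y)=\theta$ iff $x=y$; $d(x,y)=d(y,x)$; $d(x,y)\preceq d(x,z)+d(z,y)$. Convergence $x_n\to x$ means $\|d(x_n,x)\|\to0$; $(x_n)$ is Cauchy if $\|d(x_n,x_m)\|\to 0$ as $n,m\to\infty$; the space is complete if every Cauchy sequence converges. $\mathcal{F}$ is the set of functions $F:\mathbb{A}_+^3\to\mathbb{A}_+$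 such that (F1) $\max\{x,y\}\preceq F(x,y,z)$ for all $x,y,z\in\mathbb{A}_+$, meaning $x\preceq F(x,y,z)$ and $y\preceq F(x,y,z)$; (F2) $F(\theta,\theta,\theta)=\theta$; (F3) $F$ is (norm) continuous. $\varphi:X\to\mathbb{A}_+$ is lower semi-continuous if $x_n\to x$ in $X$ implies $\|\varphi(x)\|\le\liminf_n\|\varphi(x_n)\|$. $T^0$ is the identity of $X$ and $T^{n+1}=T\circ T^n$. $F_T=\{x\in X: Tx=x\}$ and $Z_\varphi=\{x\in X:\varphi(x)=\theta\}$. $T$ is a $\varphi$-Picard operator if $F_T\cap Z_\varphi=\{z\}$ for some $z\in X$ and $T^n x\to z$ as $n\to\infty$ for every $x\in X$. *)

theory Defs
  imports "HOL-Analysis.Analysis"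
begin

section \<open>Unital C*-algebras\<close>

text \<open>Complex scalars extend the real scalar multiplication of \<open>real_normed_algebra\<close>. The unit
  comes from \<open>monoid_mult\<close> rather than \<open>real_normed_algebra_1\<close>, since the latter would exclude the
  zero algebra.\<close>

class unital_cstar_algebra = real_normed_algebra + banach + monoid_mult +
  fixes scaleC :: "complex \<Rightarrow> 'a \<Rightarrow> 'a"  (infixr \<open>*\<^sub>C\<close> 75)
    and star :: "'a \<Rightarrow> 'a"
  assumes scaleC_of_real: "complex_of_real r *\<^sub>C a = r *\<^sub>R a"
    and scaleC_add_right: "c *\<^sub>C (a + b) = c *\<^sub>C a + c *\<^sub>C b"
    and scaleC_add_left: "(c + c') *\<^sub>C a = c *\<^sub>C a + c' *\<^sub>C a"
    and scaleC_scaleC: "c *\<^sub>C (c' *\<^sub>C a) = (c * c') *\<^sub>C a"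
    and mult_scaleC_left: "(c *\<^sub>C a) * b = c *\<^sub>C (a * b)"
    and mult_scaleC_right: "a * (c *\<^sub>C b) = c *\<^sub>C (a * b)"
    and norm_scaleC: "norm (c *\<^sub>C a) = cmod c * norm a"
    and star_star: "star (star a) = a"
    and star_add: "star (a + b) = star a + star b"
    and star_scaleC: "star (c *\<^sub>C a) = cnj c *\<^sub>C star a"
    and star_mult: "star (a * b) = star b * star a"
    and cstar_identity: "norm (star a * a) = (norm a)\<^sup>2"

definition self_adjoint :: "'a::unital_cstar_algebra \<Rightarrow> bool" where
  "self_adjoint a \<longleftrightarrow> star a = a"

definition spectrum :: "'a::unital_cstar_algebra \<Rightarrow> complex set" where
  "spectrum a = {c. \<not> (\<exists>b. (a - c *\<^sub>C 1) * b = 1 \<and> b * (a - c *\<^sub>C 1) = 1)}"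

definition positive_elements :: "'a::unital_cstar_algebra set"  (\<open>\<A>\<^sub>+\<close>) where
  "\<A>\<^sub>+ = {a. self_adjoint a \<and> spectrum a \<subseteq> complex_of_real ` {0..}}"

definition cstar_le :: "'a::unital_cstar_algebra \<Rightarrow> 'a \<Rightarrow> bool"  (infix \<open>\<preceq>\<close> 50) where
  "a \<preceq> b \<longleftrightarrow> self_adjoint a \<and> self_adjoint b \<and> b - a \<in> \<A>\<^sub>+"

section \<open>C*-algebra valued metrics\<close>

text \<open>The underlying set is the whole (automatically non-empty) type \<open>'x\<close>.\<close>

definition cstar_metric :: "('x \<Rightarrow> 'x \<Rightarrow> 'a::unital_cstar_algebra) \<Rightarrow> bool" where
  "cstar_metric d \<longleftrightarrow>
     (\<forall>x y. 0 \<preceq> d x y \<and> (d x y = 0 \<longleftrightarrow> x = y)) \<and>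
     (\<forall>x y. d x y = d y x) \<and>
     (\<forall>x y z. d x y \<preceq> d x z + d z y)"

definition cstar_converges ::
    "('x \<Rightarrow> 'x \<Rightarrow> 'a::unital_cstar_algebra) \<Rightarrow> (nat \<Rightarrow> 'x) \<Rightarrow> 'x \<Rightarrow> bool" where
  "cstar_converges d u x \<longleftrightarrow> (\<lambda>n. norm (d (u n) x)) \<longlonglongrightarrow> 0"

definition cstar_Cauchy ::
    "('x \<Rightarrow> 'x \<Rightarrow> 'a::unital_cstar_algebra) \<Rightarrow> (nat \<Rightarrow> 'x) \<Rightarrow> bool" where
  "cstar_Cauchy d u \<longleftrightarrow> (\<forall>e>0. \<exists>N. \<forall>n\<ge>N. \<forall>m\<ge>N. norm (d (u n) (u m)) < e)"

definition cstar_complete :: "('x \<Rightarrow> 'x \<Rightarrow> 'a::unital_cstar_algebra) \<Rightarrow> bool" where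
  "cstar_complete d \<longleftrightarrow> (\<forall>u. cstar_Cauchy d u \<longrightarrow> (\<exists>x. cstar_converges d u x))"

text \<open>The limit inferior is taken in \<open>ereal\<close>, because it may be infinite.\<close>

definition lower_semicontinuous ::
    "('x \<Rightarrow> 'x \<Rightarrow> 'a::unital_cstar_algebra) \<Rightarrow> ('x \<Rightarrow> 'a) \<Rightarrow> bool" where
  "lower_semicontinuous d \<phi> \<longleftrightarrow>
     (\<forall>u x. cstar_converges d u x \<longrightarrow>
        ereal (norm (\<phi> x)) \<le> liminf (\<lambda>n. ereal (norm (\<phi> (u n)))))"

section \<open>The class of control functions and Picard operators\<close>

text \<open>Functions \<open>\<A>\<^sub>+\<^sup>3 \<Rightarrow> \<A>\<^sub>+\<close> are represented by total functions, constrained only on \<open>\<A>\<^sub>+\<^sup>3\<close>.\<close>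

definition control_functions :: "('a::unital_cstar_algebra \<Rightarrow> 'a \<Rightarrow> 'a \<Rightarrow> 'a) set"  (\<open>\<F>\<close>) where
  "\<F> = {F.
     (\<forall>x\<in>\<A>\<^sub>+. \<forall>y\<in>\<A>\<^sub>+. \<forall>z\<in>\<A>\<^sub>+. F x y z \<in> \<A>\<^sub>+) \<and>
     (\<forall>x\<in>\<A>\<^sub>+. \<forall>y\<in>\<A>\<^sub>+. \<forall>z\<in>\<A>\<^sub>+. x \<preceq> F x y z \<and> y \<preceq> F x y z) \<and>
     F 0 0 0 = 0 \<and>
     continuous_on (\<A>\<^sub>+ \<times> \<A>\<^sub>+ \<times> \<A>\<^sub>+) (\<lambda>(x, y, z). F x y z)}"

definition fixed_points :: "('x \<Rightarrow> 'x) \<Rightarrow> 'x set" where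
  "fixed_points T = {x. T x = x}"

definition zero_set :: "('x \<Rightarrow> 'a::zero) \<Rightarrow> 'x set" where
  "zero_set \<phi> = {x. \<phi> x = 0}"

definition phi_Picard ::
    "('x \<Rightarrow> 'x \<Rightarrow> 'a::unital_cstar_algebra) \<Rightarrow> ('x \<Rightarrow> 'a) \<Rightarrow> ('x \<Rightarrow> 'x) \<Rightarrow> bool" where
  "phi_Picard d \<phi> T \<longleftrightarrow>
     (\<exists>z. fixed_points T \<inter> zero_set \<phi> = {z} \<and>
          (\<forall>x. cstar_converges d (\<lambda>n. (T ^^ n) x) z))"

end

theory Submission
  imports Defs
begin

text \<open>
  Taking norms reduces the theorem to a scalar fixed point argument. The one fact about
  \<open>C\<^sup>*\<close>-algebras needed for this is that the norm is monotone on positive elements: if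
  \<open>0 \<preceq> a \<preceq> b\<close> then \<open>\<parallel>a\<parallel> \<le> \<parallel>b\<parallel>\<close> (\<open>norm_mono_positive\<close>).

  Monotonicity rests on \<open>self_adjoint_spectrum_attains_norm\<close>: the spectrum of a nonzero
  self-adjoint \<open>h\<close> contains a point of modulus \<open>\<parallel>h\<parallel>\<close>. The usual proof applies complex analysis to
  the resolvent; here an averaging argument suffices. Normalise \<open>\<parallel>h\<parallel> = 1\<close>, so that
  \<open>\<parallel>h\<^bsup>2^n\<^esup>\<parallel> = 1\<close> for all \<open>n\<close> by the \<open>C\<^sup>*\<close>-identity, and suppose that \<open>1 - w h\<close> is invertible whenever
  \<open>\<bar>w\<bar> = 1\<close>. By compactness \<open>(1 - w h)\<^sup>-\<^sup>1\<close> and \<open>(1 - \<rho> w h)\<^sup>-\<^sup>1\<close> are uniformly close on the circle for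
  some \<open>\<rho> < 1\<close>. The identity \<open>(1 - x\<^sup>2)\<^sup>-\<^sup>1 = ((1 - x)\<^sup>-\<^sup>1 + (1 + x)\<^sup>-\<^sup>1) / 2\<close> passes this closeness on,
  without loss, to the powers \<open>h\<^bsup>2^n\<^esup>\<close> with \<open>\<rho>\<^bsup>2^n\<^esup>\<close> in place of \<open>\<rho>\<close>. For large \<open>n\<close> the second
  resolvent is close to \<open>1\<close>, hence so is \<open>(1 - h\<^bsup>2^n\<^esup>)\<^sup>-\<^sup>1\<close>, which forces \<open>\<parallel>h\<^bsup>2^n\<^esup>\<parallel> < 1\<close>.

  For the fixed point, put \<open>M x y = F (d x y) (\<phi> x) (\<phi> y)\<close> and write \<open>N x y\<close> for its norm. By
  monotonicity the hypothesis on \<open>T\<close> becomes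
  \<open>N (T x) (T y) \<le> \<alpha> N x y + \<beta> N x (T x) + \<gamma> N y (T y)\<close>, while \<open>\<parallel>d x y\<parallel>\<close> and \<open>\<parallel>\<phi> x\<parallel>\<close> are
  both at most \<open>N x y\<close>. Along an orbit \<open>x\<^sub>n\<close> the numbers \<open>N x\<^sub>n x\<^sub>n\<^sub>+\<^sub>1\<close> decay geometrically, so the
  orbit converges to some \<open>z\<close>, and \<open>\<phi> z = 0\<close> by lower semicontinuity. Letting \<open>n \<rightarrow> \<infinity>\<close> in the
  inequality for \<open>x\<^sub>n\<close> and \<open>z\<close>, by continuity of \<open>F\<close> and \<open>d\<close>, gives \<open>N z (T z) \<le> \<gamma> N z (T z)\<close>, so
  \<open>T z = z\<close>. At any fixed point \<open>z\<close> the inequality gives \<open>N z z \<le> (\<alpha> + \<beta> + \<gamma>) N z z\<close>, so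
  \<open>N z z = 0\<close> and \<open>\<phi> z = 0\<close>; for two fixed points it then gives \<open>N z w \<le> \<alpha> N z w\<close>, so they
  coincide.
\<close>

section \<open>Inverses and the Neumann series\<close>

lemma scaleC_zero_left: "0 *\<^sub>C (a::'a::unital_cstar_algebra) = 0"
  using norm_scaleC[of 0 a] by simp

lemma scaleC_one: "1 *\<^sub>C (a::'a::unital_cstar_algebra) = a"
  using scaleC_of_real[of 1 a] by simp

lemma scaleC_minus_left: "(- c) *\<^sub>C (a::'a::unital_cstar_algebra) = - (c *\<^sub>C a)"
  using scaleC_add_left[of c "- c" a] by (simp add: scaleC_zero_left eq_neg_iff_add_eq_0 add.commute)

lemma scaleC_diff_left: "(c - c') *\<^sub>C (a::'a::unital_cstar_algebra) = c *\<^sub>C a - c' *\<^sub>C a"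
  using scaleC_add_left[of c "- c'" a] by (simp add: scaleC_minus_left)

lemma scaleC_diff_right: "c *\<^sub>C ((a::'a::unital_cstar_algebra) - b) = c *\<^sub>C a - c *\<^sub>C b"
  using scaleC_add_right[of c "a - b" b] by simp

lemma star_one: "star (1::'a::unital_cstar_algebra) = 1"
  using star_mult[of "star 1" "1::'a"] by (simp add: star_star)

lemma star_scaleR: "star (r *\<^sub>R (a::'a::unital_cstar_algebra)) = r *\<^sub>R star a"
  using star_scaleC[of "complex_of_real r" a] by (simp add: scaleC_of_real)

lemma star_diff: "star ((a::'a::unital_cstar_algebra) - b) = star a - star b"
  using star_add[of "a - b" b] by simp

lemma norm_one_le: "norm (1::'a::unital_cstar_algebra) \<le> 1"
proof -
  have "norm (1::'a) = norm (1::'a) * norm (1::'a)"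
    using cstar_identity[of "1::'a"] by (simp add: star_one power2_eq_square)
  then show ?thesis by (cases "norm (1::'a) = 0") auto
qed

lemma norm_power_le: "norm ((a::'a::unital_cstar_algebra) ^ n) \<le> norm a ^ n"
proof (induction n)
  case 0
  show ?case using norm_one_le by simp
next
  case (Suc n)
  have "norm (a ^ Suc n) \<le> norm a * norm (a ^ n)" by (simp add: norm_mult_ineq)
  also have "\<dots> \<le> norm a * norm a ^ n" using Suc by (simp add: mult_left_mono)
  finally show ?case by simp
qed

definition inverse_pair :: "'a::unital_cstar_algebra \<Rightarrow> 'a \<Rightarrow> bool" where
  "inverse_pair x y \<longleftrightarrow> x * y = 1 \<and> y * x = 1"

lemma neumann_inverse:
  assumes "norm (x::'a::unital_cstar_algebra) < 1"
  shows "\<exists>y. inverse_pair (1 - x) y"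
proof -
  have "summable (\<lambda>n. norm x ^ n)" using assms by simp
  then have sm: "summable (\<lambda>n. x ^ n)"
    by (rule summable_comparison_test'[where N = 0]) (rule norm_power_le)
  let ?y = "\<Sum>n. x ^ n"
  have split: "?y = 1 + (\<Sum>n. x ^ Suc n)"
    using suminf_split_head[OF sm] by simp
  have "(\<Sum>n. x ^ Suc n) = x * ?y" using suminf_mult[OF sm, of x] by simp
  moreover have "(\<Sum>n. x ^ Suc n) = ?y * x"
    using suminf_mult2[OF sm, of x] by (simp only: power_Suc2)
  ultimately have "?y - x * ?y = 1" "?y - ?y * x = 1" using split by (simp_all add: algebra_simps)
  then have "inverse_pair (1 - x) ?y"
    by (simp add: inverse_pair_def algebra_simps)
  then show ?thesis ..
qed

lemma inverse_perturbation:
  assumes "inverse_pair (x::'a::unital_cstar_algebra) y" "inverse_pair x' y'"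
    and small: "norm (x - x') * norm y \<le> 1 / 2"
  shows "norm y' \<le> 2 * norm y" "norm (y' - y) \<le> 2 * (norm y)\<^sup>2 * norm (x - x')"
proof -
  have "y' - y = y' * ((x - x') * y)"
  proof -
    have "y' * ((x - x') * y) = y' * (x * y) - (y' * x') * y" by (simp add: algebra_simps)
    then show ?thesis using assms(1,2) by (simp add: inverse_pair_def)
  qed
  then have diff: "norm (y' - y) \<le> norm y' * (norm (x - x') * norm y)"
    by (metis mult_left_mono norm_ge_zero norm_mult_ineq order_trans)
  also have "\<dots> \<le> norm y' * (1 / 2)" using small by (intro mult_left_mono) auto
  finally have "norm (y' - y) \<le> norm y' / 2" by simp
  moreover have "norm y' \<le> norm y + norm (y' - y)" by norm
  ultimately show bound: "norm y' \<le> 2 * norm y" by simp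
  have "norm y' * (norm (x - x') * norm y) \<le> (2 * norm y) * (norm (x - x') * norm y)"
    using bound by (intro mult_right_mono) auto
  with diff show "norm (y' - y) \<le> 2 * (norm y)\<^sup>2 * norm (x - x')"
    by (simp add: power2_eq_square mult_ac)
qed

text \<open>This is the partial fraction identity \<open>2 / (1 - x\<^sup>2) = 1 / (1 - x) + 1 / (1 + x)\<close>.\<close>

lemma inverse_pair_one_minus_square:
  assumes "inverse_pair (1 - (x::'a::unital_cstar_algebra)) y" "inverse_pair (1 + x) y'"
  shows "inverse_pair (1 - x * x) ((1/2) *\<^sub>R (y + y'))"
proof -
  have e: "1 - x * x = (1 + x) * (1 - x)" "1 - x * x = (1 - x) * (1 + x)"
    by (simp_all add: algebra_simps)
  have "(1 - x * x) * y = 1 + x" "y * (1 - x * x) = 1 + x"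
    using assms(1) unfolding inverse_pair_def
    by (metis e(1) mult.assoc mult.right_neutral, metis e(2) mult.assoc mult.left_neutral)
  moreover have "(1 - x * x) * y' = 1 - x" "y' * (1 - x * x) = 1 - x"
    using assms(2) unfolding inverse_pair_def
    by (metis e(2) mult.assoc mult.right_neutral, metis e(1) mult.assoc mult.left_neutral)
  ultimately have "(1 - x * x) * (y + y') = 1 + 1" "(y + y') * (1 - x * x) = 1 + 1"
    by (simp_all add: distrib_left distrib_right)
  moreover have "(1/2) *\<^sub>R ((1::'a) + 1) = 1"
    by (metis scaleR_half_double)
  ultimately show ?thesis by (simp add: inverse_pair_def)
qed

lemma not_in_spectrum_if_inverse_pair:
  assumes "c \<noteq> 0" "inverse_pair (1 - inverse c *\<^sub>C (a::'a::unital_cstar_algebra)) y"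
  shows "c \<notin> spectrum a"
proof -
  let ?z = "1 - inverse c *\<^sub>C a"
  have e: "a - c *\<^sub>C 1 = (- c) *\<^sub>C ?z"
    using assms(1) by (simp add: scaleC_minus_left scaleC_diff_right scaleC_scaleC scaleC_one)
  have "(a - c *\<^sub>C 1) * ((- inverse c) *\<^sub>C y) = 1" "((- inverse c) *\<^sub>C y) * (a - c *\<^sub>C 1) = 1"
    unfolding e using assms
    by (simp_all add: inverse_pair_def mult_scaleC_left mult_scaleC_right scaleC_scaleC scaleC_one)
  then show ?thesis by (auto simp: spectrum_def)
qed

lemma spectrum_norm_bound:
  assumes "c \<in> spectrum (a::'a::unital_cstar_algebra)"
  shows "cmod c \<le> norm a"
proof (rule ccontr)
  assume "\<not> cmod c \<le> norm a"
  then have c: "cmod c > norm a" "c \<noteq> 0" by auto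
  then have "norm (inverse c *\<^sub>C a) < 1"
    by (simp add: norm_scaleC norm_inverse inverse_eq_divide norm_divide)
  then show False
    using neumann_inverse not_in_spectrum_if_inverse_pair c(2) assms by blast
qed

lemma spectrum_translate:
  assumes "c \<in> spectrum (a::'a::unital_cstar_algebra)"
  shows "c + complex_of_real t \<in> spectrum (a + t *\<^sub>R 1)"
  using assms by (simp add: spectrum_def scaleC_add_left scaleC_of_real)

lemma spectrum_reflect:
  assumes "c \<in> spectrum (t *\<^sub>R 1 - (a::'a::unital_cstar_algebra))"
  shows "complex_of_real t - c \<in> spectrum a"
proof (rule ccontr)
  assume "complex_of_real t - c \<notin> spectrum a"
  then obtain b where b: "(a - (complex_of_real t - c) *\<^sub>C 1) * b = 1"
      "b * (a - (complex_of_real t - c) *\<^sub>C 1) = 1"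
    by (auto simp: spectrum_def)
  have "t *\<^sub>R 1 - a - c *\<^sub>C 1 = - (a - (complex_of_real t - c) *\<^sub>C 1)"
    by (simp add: scaleC_diff_left scaleC_of_real)
  then have "(t *\<^sub>R 1 - a - c *\<^sub>C 1) * (- b) = 1" "(- b) * (t *\<^sub>R 1 - a - c *\<^sub>C 1) = 1"
    using b by (simp_all only: minus_mult_minus)
  then show False using assms unfolding spectrum_def by blast
qed

section \<open>The spectrum of a self-adjoint element attains the norm\<close>

text \<open>Invertibility along the circle gives bounded inverses by compactness: if the inverses blew up
  along a sequence, \<open>inverse_perturbation\<close> at a limit point would bound them.\<close>

lemma resolvent_bounded_on_circle:
  fixes h :: "'a::unital_cstar_algebra"
  assumes inv: "\<And>w. cmod w = 1 \<Longrightarrow> inverse_pair (1 - w *\<^sub>C h) (f w)"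
  shows "\<exists>B>0. \<forall>w. cmod w = 1 \<longrightarrow> norm (f w) \<le> B"
proof (rule ccontr)
  assume neg: "\<not> ?thesis"
  have "\<exists>w. cmod w = 1 \<and> norm (f w) > real (Suc n)" for n
    using neg by (metis not_le of_nat_0_less_iff zero_less_Suc)
  then obtain u where u: "\<And>n. cmod (u n) = 1" "\<And>n. norm (f (u n)) > real (Suc n)" by metis
  have "compact (sphere (0::complex) 1)" by simp
  moreover have "\<forall>n. u n \<in> sphere 0 1" using u(1) by simp
  ultimately obtain l r where l: "l \<in> sphere 0 1" and r: "strict_mono (r::nat \<Rightarrow> nat)"
    and lim: "(u \<circ> r) \<longlonglongrightarrow> l"
    unfolding compact_def by metis
  let ?g = "\<lambda>n. norm ((1 - l *\<^sub>C h) - (1 - u (r n) *\<^sub>C h)) * norm (f l)"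
  have g: "?g n = cmod (u (r n) - l) * norm h * norm (f l)" for n
    by (simp add: scaleC_diff_left[symmetric] norm_scaleC)
  have "(\<lambda>n. cmod (u (r n) - l)) \<longlonglongrightarrow> 0"
    using lim by (simp add: LIM_zero tendsto_norm_zero comp_def)
  then have "?g \<longlonglongrightarrow> 0" unfolding g by (auto intro!: tendsto_mult_left_zero)
  then have "\<forall>\<^sub>F n in sequentially. ?g n < 1 / 2"
    by (rule order_tendstoD) simp
  then have ev: "\<forall>\<^sub>F n in sequentially. norm (f (u (r n))) \<le> 2 * norm (f l)"
  proof eventually_elim
    case (elim n)
    show ?case
      using inverse_perturbation(1)[OF inv[of l] inv[of "u (r n)"]] elim l u(1) by simp
  qed
  obtain K where K: "\<And>n. n \<ge> K \<Longrightarrow> norm (f (u (r n))) \<le> 2 * norm (f l)"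
    using ev by (auto simp: eventually_sequentially)
  obtain m :: nat where m: "2 * norm (f l) < real m" using reals_Archimedean2 by blast
  let ?n = "max K m"
  have "real m \<le> real (Suc (r ?n))" using seq_suble[OF r, of ?n] by linarith
  also have "\<dots> < norm (f (u (r ?n)))" using u(2) .
  also have "\<dots> \<le> 2 * norm (f l)" using K by simp
  finally show False using m by simp
qed

text \<open>Each unit \<open>v\<close> is the square of a unit \<open>w\<close>, so that the resolvent of \<open>h\<^bsup>2^(n+1)\<^esup>\<close> at \<open>v\<close> is the
  mean of the resolvents of \<open>h\<^bsup>2^n\<^esup>\<close> at \<open>w\<close> and \<open>-w\<close>; taking means preserves the bound \<open>\<epsilon>\<close>.\<close>

lemma resolvent_closeness_squaring:
  fixes h :: "'a::unital_cstar_algebra"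
  assumes base: "\<And>w. cmod w = 1 \<Longrightarrow> \<exists>y z. inverse_pair (1 - w *\<^sub>C h) y \<and>
      inverse_pair (1 - (of_real \<rho> * w) *\<^sub>C h) z \<and> norm (y - z) \<le> \<epsilon>"
    and "cmod w = 1"
  shows "\<exists>y z. inverse_pair (1 - w *\<^sub>C h ^ 2 ^ n) y \<and>
      inverse_pair (1 - (of_real (\<rho> ^ 2 ^ n) * w) *\<^sub>C h ^ 2 ^ n) z \<and> norm (y - z) \<le> \<epsilon>"
  using assms(2)
proof (induction n arbitrary: w)
  case 0
  then show ?case using base by simp
next
  case (Suc n)
  define k where "k = h ^ 2 ^ n"
  define q where "q = complex_of_real (\<rho> ^ 2 ^ n)"
  define s where "s = csqrt w"
  have s: "s * s = w" "cmod s = 1"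
    using Suc.prems by (auto simp: s_def power2_eq_square[symmetric])
  obtain y1 z1 where 1: "inverse_pair (1 - s *\<^sub>C k) y1" "inverse_pair (1 - (q * s) *\<^sub>C k) z1"
      "norm (y1 - z1) \<le> \<epsilon>"
    using Suc.IH[of s] s by (auto simp: k_def q_def)
  obtain y2 z2 where 2: "inverse_pair (1 + s *\<^sub>C k) y2" "inverse_pair (1 + (q * s) *\<^sub>C k) z2"
      "norm (y2 - z2) \<le> \<epsilon>"
    using Suc.IH[of "- s"] s by (auto simp: k_def q_def scaleC_minus_left)
  have kk: "h ^ 2 ^ Suc n = k * k" by (simp add: k_def power_add[symmetric] mult_2)
  have qq: "complex_of_real (\<rho> ^ 2 ^ Suc n) = q * q" by (simp add: q_def power_add[symmetric] mult_2)
  have "inverse_pair (1 - w *\<^sub>C (k * k)) ((1/2) *\<^sub>R (y1 + y2))"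
    using inverse_pair_one_minus_square[OF 1(1) 2(1)] s(1)
    by (simp add: mult_scaleC_left mult_scaleC_right scaleC_scaleC)
  moreover have "inverse_pair (1 - (q * q * w) *\<^sub>C (k * k)) ((1/2) *\<^sub>R (z1 + z2))"
    using inverse_pair_one_minus_square[OF 1(2) 2(2)] s(1)
    by (simp add: mult_scaleC_left mult_scaleC_right scaleC_scaleC mult_ac)
  moreover have "norm ((1/2) *\<^sub>R (y1 + y2) - (1/2) *\<^sub>R (z1 + z2)) \<le> \<epsilon>"
  proof -
    have "(1/2) *\<^sub>R (y1 + y2) - (1/2) *\<^sub>R (z1 + z2) = (1/2) *\<^sub>R ((y1 - z1) + (y2 - z2))"
      by (simp add: algebra_simps)
    then show ?thesis
      using norm_triangle_ineq[of "y1 - z1" "y2 - z2"] 1(3) 2(3) by simp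
  qed
  ultimately show ?case unfolding kk qq by blast
qed

lemma circle_meets_spectrum:
  fixes h :: "'a::unital_cstar_algebra"
  assumes norm_pow: "\<And>n. norm (h ^ 2 ^ n) = 1"
  shows "\<exists>w. cmod w = 1 \<and> (\<nexists>y. inverse_pair (1 - w *\<^sub>C h) y)"
proof (rule ccontr)
  assume "\<not> ?thesis"
  then obtain f where f: "\<And>w. cmod w = 1 \<Longrightarrow> inverse_pair (1 - w *\<^sub>C h) (f w)" by metis
  obtain B where B: "B > 0" "\<And>w. cmod w = 1 \<Longrightarrow> norm (f w) \<le> B"
    using resolvent_bounded_on_circle[of h f] f by blast
  have h1: "norm h = 1" using norm_pow[of 0] by simp
  \<comment> \<open>The constants make \<open>\<delta> * B \<le> 1/2\<close>, as \<open>inverse_perturbation\<close> requires, and its bound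
    \<open>2 * B\<^sup>2 * \<delta>\<close> at most \<open>1/8\<close>.\<close>
  define \<delta> where "\<delta> = min (1/2) (min (1 / (2 * B)) (1 / (16 * B\<^sup>2)))"
  have \<delta>: "0 < \<delta>" "\<delta> \<le> 1/2" "\<delta> * B \<le> 1/2" "2 * B\<^sup>2 * \<delta> \<le> 1/8"
  proof -
    show "0 < \<delta>" "\<delta> \<le> 1/2" using B(1) by (auto simp: \<delta>_def)
    have "\<delta> \<le> 1 / (2 * B)" "\<delta> \<le> 1 / (16 * B\<^sup>2)" by (auto simp: \<delta>_def)
    then show "\<delta> * B \<le> 1/2" "2 * B\<^sup>2 * \<delta> \<le> 1/8" using B(1) by (simp_all add: field_simps)
  qed
  define \<rho> where "\<rho> = 1 - \<delta>"
  have \<rho>: "0 \<le> \<rho>" "\<rho> < 1" using \<delta> by (auto simp: \<rho>_def)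
  have base: "\<exists>y z. inverse_pair (1 - w *\<^sub>C h) y \<and>
      inverse_pair (1 - (of_real \<rho> * w) *\<^sub>C h) z \<and> norm (y - z) \<le> 1/8" if w: "cmod w = 1" for w
  proof -
    have "norm ((of_real \<rho> * w) *\<^sub>C h) < 1" using \<rho> w h1 by (simp add: norm_scaleC norm_mult)
    then obtain z where z: "inverse_pair (1 - (of_real \<rho> * w) *\<^sub>C h) z"
      using neumann_inverse by blast
    have "(1 - w *\<^sub>C h) - (1 - (of_real \<rho> * w) *\<^sub>C h) = (- (of_real \<delta> * w)) *\<^sub>C h"
      by (simp add: \<rho>_def scaleC_minus_left left_diff_distrib scaleC_diff_left)
    then have dist: "norm ((1 - w *\<^sub>C h) - (1 - (of_real \<rho> * w) *\<^sub>C h)) = \<delta>"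
      using w h1 \<delta>(1) by (simp add: norm_scaleC norm_mult)
    have "\<delta> * norm (f w) \<le> \<delta> * B" using B(2)[OF w] \<delta>(1) by simp
    then have "norm (z - f w) \<le> 2 * (norm (f w))\<^sup>2 * \<delta>"
      using inverse_perturbation(2)[OF f[OF w] z] dist \<delta>(3) by simp
    also have "\<dots> \<le> 2 * B\<^sup>2 * \<delta>"
      using B(2)[OF w] \<delta>(1) by (simp add: mult_right_mono power_mono)
    finally show ?thesis using f[OF w] z \<delta>(4) by (metis norm_minus_commute order_trans)
  qed
  obtain n0 where n0: "\<rho> ^ n0 < 1/16" using real_arch_pow_inv[of "1/16" \<rho>] \<rho> by auto
  define q where "q = \<rho> ^ 2 ^ n0"
  have "n0 \<le> 2 ^ n0" by (simp add: less_exp less_imp_le)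
  then have q: "0 \<le> q" "q < 1/16"
    using n0 \<rho> power_decreasing[of n0 "2 ^ n0" \<rho>] by (auto simp: q_def)
  define k where "k = h ^ 2 ^ n0"
  have k1: "norm k = 1" using norm_pow by (simp add: k_def)
  obtain y z where yz: "inverse_pair (1 - k) y" "inverse_pair (1 - of_real q *\<^sub>C k) z"
      "norm (y - z) \<le> 1/8"
    using resolvent_closeness_squaring[OF base, of 1 n0]
    by (auto simp: k_def q_def scaleC_one)
  \<comment> \<open>Since \<open>z = 1 + q k z\<close> with \<open>q\<close> small, \<open>z\<close> is near \<open>1\<close>.\<close>
  have "z - 1 = q *\<^sub>R (k * (z - 1)) + q *\<^sub>R k"
    using yz(2) by (simp add: inverse_pair_def scaleC_of_real algebra_simps)
  then have "norm (z - 1) \<le> q * norm (k * (z - 1)) + q"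
    using norm_triangle_ineq[of "q *\<^sub>R (k * (z - 1))" "q *\<^sub>R k"] q(1) k1 by simp
  also have "\<dots> \<le> q * norm (z - 1) + q"
    using q(1) norm_mult_ineq[of k "z - 1"] k1 by (simp add: mult_left_mono)
  also have "\<dots> \<le> (1/16) * norm (z - 1) + 1/16"
    using q by (intro add_mono mult_right_mono) auto
  finally have "norm (z - 1) \<le> 1/8" by simp
  moreover have "norm (y - 1) \<le> norm (y - z) + norm (z - 1)" by norm
  ultimately have y1: "norm (y - 1) \<le> 1/4" using yz(3) by simp
  \<comment> \<open>Solving \<open>y = 1 + k y\<close> for \<open>k\<close> shows that \<open>k\<close> is small.\<close>
  have "k = (y - 1) - k * (y - 1)"
    using yz(1) by (simp add: inverse_pair_def algebra_simps)
  then have "norm k \<le> norm (y - 1) + norm (k * (y - 1))"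
    by (metis norm_triangle_ineq4)
  also have "\<dots> \<le> norm (y - 1) + norm (y - 1)"
    using norm_mult_ineq[of k "y - 1"] k1 by simp
  finally show False using y1 k1 by simp
qed

lemma star_power: "star ((a::'a::unital_cstar_algebra) ^ n) = star a ^ n"
  by (induction n) (simp_all add: star_one star_mult power_commutes)

lemma norm_self_adjoint_power:
  assumes "self_adjoint (h::'a::unital_cstar_algebra)"
  shows "norm (h ^ 2 ^ n) = norm h ^ 2 ^ n"
proof (induction n)
  case 0
  show ?case by simp
next
  case (Suc n)
  have "h ^ 2 ^ Suc n = star (h ^ 2 ^ n) * h ^ 2 ^ n"
    using assms by (simp add: star_power self_adjoint_def power_add[symmetric] mult_2)
  then have "norm (h ^ 2 ^ Suc n) = (norm (h ^ 2 ^ n))\<^sup>2" by (simp add: cstar_identity)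
  then show ?case using Suc by (simp add: power_mult[symmetric] mult.commute)
qed

lemma self_adjoint_spectrum_attains_norm:
  assumes h: "self_adjoint (h::'a::unital_cstar_algebra)" and nz: "h \<noteq> 0"
  shows "\<exists>c\<in>spectrum h. cmod c = norm h"
proof -
  define R where "R = norm h"
  have R: "R > 0" using nz by (simp add: R_def)
  define g where "g = (1 / R) *\<^sub>R h"
  have "self_adjoint g" using h by (simp add: self_adjoint_def g_def star_scaleR)
  moreover have "norm g = 1" using R nz by (simp add: g_def R_def)
  ultimately obtain w where w: "cmod w = 1" "\<nexists>y. inverse_pair (1 - w *\<^sub>C g) y"
    using circle_meets_spectrum[of g] norm_self_adjoint_power[of g] by auto
  define c where "c = of_real R * inverse w"
  have c: "cmod c = R" using w(1) R by (simp add: c_def norm_mult norm_inverse)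
  have wg: "w *\<^sub>C g = inverse c *\<^sub>C h"
    using R by (simp add: g_def c_def scaleC_of_real[symmetric] scaleC_scaleC field_simps)
  have "c \<in> spectrum h"
  proof (rule ccontr)
    assume "c \<notin> spectrum h"
    then obtain b where b: "(h - c *\<^sub>C 1) * b = 1" "b * (h - c *\<^sub>C 1) = 1"
      by (auto simp: spectrum_def)
    have "c \<noteq> 0" using c R by auto
    then have "1 - inverse c *\<^sub>C h = (- inverse c) *\<^sub>C (h - c *\<^sub>C 1)"
      by (simp add: scaleC_minus_left scaleC_diff_right scaleC_scaleC scaleC_one)
    then have "inverse_pair (1 - inverse c *\<^sub>C h) ((- c) *\<^sub>C b)"
      using b \<open>c \<noteq> 0\<close>
      by (simp add: inverse_pair_def mult_scaleC_left mult_scaleC_right scaleC_scaleC scaleC_one)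
    then show False using w(2) wg by auto
  qed
  then show ?thesis using c by (auto simp: R_def)
qed

section \<open>Monotonicity of the norm on positive elements\<close>

lemma positive_norm_in_spectrum:
  assumes "a \<in> \<A>\<^sub>+" "a \<noteq> 0"
  shows "complex_of_real (norm a) \<in> spectrum a"
proof -
  obtain c where c: "c \<in> spectrum a" "cmod c = norm a"
    using self_adjoint_spectrum_attains_norm assms by (auto simp: positive_elements_def)
  moreover obtain s where "c = complex_of_real s" "s \<ge> 0"
    using c(1) assms(1) by (auto simp: positive_elements_def)
  ultimately show ?thesis by auto
qed

text \<open>The spectrum of \<open>t - p\<close> lies in \<open>[0, t]\<close>, and its norm is attained there.\<close>

lemma norm_scalar_minus_positive:
  assumes p: "(p::'a::unital_cstar_algebra) \<in> \<A>\<^sub>+" and t: "norm p \<le> t"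
  shows "norm (t *\<^sub>R 1 - p) \<le> t"
proof (cases "t *\<^sub>R 1 - p = 0")
  case True
  have "0 \<le> t" using t norm_ge_zero order_trans by blast
  then show ?thesis using True by simp
next
  case False
  have "self_adjoint (t *\<^sub>R 1 - p)"
    using p by (simp add: positive_elements_def self_adjoint_def star_diff star_scaleR star_one)
  then obtain c where c: "c \<in> spectrum (t *\<^sub>R 1 - p)" "cmod c = norm (t *\<^sub>R 1 - p)"
    using self_adjoint_spectrum_attains_norm False by blast
  have sp: "complex_of_real t - c \<in> spectrum p" using spectrum_reflect c(1) by blast
  then obtain s where s: "complex_of_real t - c = complex_of_real s" "s \<ge> 0"
    using p by (auto simp: positive_elements_def)
  have "s \<le> t" using spectrum_norm_bound[OF sp] s t by simp
  have "c = complex_of_real (t - s)" using s(1) by (simp add: algebra_simps)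
  then have "cmod c = \<bar>t - s\<bar>" by (simp only: norm_of_real)
  then show ?thesis using c(2) s(2) \<open>s \<le> t\<close> by simp
qed

text \<open>With \<open>p = b - a\<close> and \<open>t = \<parallel>p\<parallel>\<close>, the point \<open>\<parallel>a\<parallel> + t\<close> lies in the spectrum of
  \<open>a + t = b + (t - p)\<close>, whose norm is at most \<open>\<parallel>b\<parallel> + t\<close>. This avoids showing that sums of
  positive elements are positive.\<close>

lemma norm_mono_positive:
  assumes a: "(a::'a::unital_cstar_algebra) \<in> \<A>\<^sub>+" and ba: "b - a \<in> \<A>\<^sub>+"
  shows "norm a \<le> norm b"
proof (cases "a = 0")
  case False
  define t where "t = norm (b - a)"
  have "complex_of_real (norm a) + complex_of_real t \<in> spectrum (a + t *\<^sub>R 1)"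
    using spectrum_translate positive_norm_in_spectrum[OF a False] by blast
  then have "cmod (complex_of_real (norm a + t)) \<le> norm (a + t *\<^sub>R 1)"
    using spectrum_norm_bound by fastforce
  then have "norm a + t \<le> norm (a + t *\<^sub>R 1)"
    unfolding norm_of_real by (simp add: t_def)
  also have "a + t *\<^sub>R 1 = b + (t *\<^sub>R 1 - (b - a))" by simp
  also have "norm \<dots> \<le> norm b + norm (t *\<^sub>R 1 - (b - a))" by (rule norm_triangle_ineq)
  also have "\<dots> \<le> norm b + t"
    using norm_scalar_minus_positive[OF ba, of t] by (simp add: t_def)
  finally show ?thesis by simp
qed simp

lemma norm_mono_cstar_le:
  assumes "a \<in> \<A>\<^sub>+" "a \<preceq> b"
  shows "norm a \<le> norm b"
  using assms norm_mono_positive by (auto simp: cstar_le_def)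

section \<open>Norms of C*-algebra valued metrics\<close>

context
  fixes d :: "'x \<Rightarrow> 'x \<Rightarrow> 'a::unital_cstar_algebra"
  assumes d: "cstar_metric d"
begin

lemma metric_positive: "d x y \<in> \<A>\<^sub>+"
  using d by (auto simp: cstar_metric_def cstar_le_def)

lemma metric_eq_0_iff: "d x y = 0 \<longleftrightarrow> x = y"
  using d by (auto simp: cstar_metric_def)

lemma metric_commute: "d x y = d y x"
  using d by (auto simp: cstar_metric_def)

lemma metric_triangle: "d x y \<preceq> d x z + d z y"
  using d by (auto simp: cstar_metric_def)

lemma metric_norm_triangle: "norm (d x y) \<le> norm (d x z) + norm (d z y)"
  using norm_mono_cstar_le[OF metric_positive metric_triangle] norm_triangle_ineq order_trans by blast

text \<open>For \<open>a = d u y - d x y\<close> and \<open>b = d u x\<close> the triangle inequality says \<open>-b \<preceq> a \<preceq> b\<close>, that is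
  \<open>0 \<preceq> a + b \<preceq> 2 b\<close>. The constant \<open>1\<close> in place of \<open>3\<close> also holds, but continuity needs only some
  constant, and \<open>3\<close> comes from monotonicity of the norm alone.\<close>

lemma metric_norm_diff: "norm (d u y - d x y) \<le> 3 * norm (d u x)"
proof -
  define a where "a = d u y - d x y"
  define b where "b = d u x"
  have "a + b \<in> \<A>\<^sub>+"
    using metric_triangle[of x y u] metric_commute[of x u]
    by (simp add: cstar_le_def a_def b_def algebra_simps)
  moreover have "(2 *\<^sub>R b) - (a + b) \<in> \<A>\<^sub>+"
    using metric_triangle[of u y x]
    by (simp add: cstar_le_def a_def b_def algebra_simps scaleR_2)
  ultimately have "norm (a + b) \<le> norm (2 *\<^sub>R b)" by (rule norm_mono_positive)
  then have "norm (a + b) \<le> 2 * norm b" by simp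
  moreover have "norm a \<le> norm (a + b) + norm b" using norm_triangle_ineq4[of "a + b" b] by simp
  ultimately show ?thesis by (simp add: a_def b_def)
qed

lemma metric_tendsto:
  assumes "cstar_converges d u x"
  shows "(\<lambda>n. d (u n) y) \<longlonglongrightarrow> d x y"
proof -
  have "(\<lambda>n. 3 * norm (d (u n) x)) \<longlonglongrightarrow> 0"
    using assms by (auto simp: cstar_converges_def intro: tendsto_mult_right_zero)
  then have "(\<lambda>n. d (u n) y - d x y) \<longlonglongrightarrow> 0"
    by (rule tendsto_0_le[where K = 1]) (simp add: metric_norm_diff)
  then show ?thesis by (rule LIM_zero_cancel)
qed

lemma Cauchy_if_geometric_steps:
  assumes r: "0 \<le> r" "r < 1" and step: "\<And>n. norm (d (u n) (u (Suc n))) \<le> C * r ^ n"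
  shows "cstar_Cauchy d u"
proof -
  have C: "0 \<le> C" using order_trans[OF norm_ge_zero step[of 0]] by simp
  have tail: "norm (d (u n) (u (n + k))) \<le> C * r ^ n / (1 - r)" for n k
  proof (induction k arbitrary: n)
    case 0
    show ?case using C r metric_eq_0_iff[of "u n" "u n"] by simp
  next
    case (Suc k)
    have "norm (d (u n) (u (n + Suc k)))
        \<le> norm (d (u n) (u (Suc n))) + norm (d (u (Suc n)) (u (Suc n + k)))"
      using metric_norm_triangle by simp
    also have "\<dots> \<le> C * r ^ n + C * r ^ Suc n / (1 - r)"
      by (intro add_mono step Suc.IH)
    also have "\<dots> = C * r ^ n / (1 - r)" using r by (simp add: field_simps)
    finally show ?case .
  qed
  have "(\<lambda>n. C * r ^ n / (1 - r)) \<longlonglongrightarrow> 0"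
    using r by (auto intro!: tendsto_divide_zero tendsto_mult_right_zero LIMSEQ_power_zero)
  show ?thesis
    unfolding cstar_Cauchy_def
  proof (intro allI impI)
    fix e :: real
    assume "0 < e"
    then have "\<forall>\<^sub>F n in sequentially. C * r ^ n / (1 - r) < e"
      using \<open>(\<lambda>n. C * r ^ n / (1 - r)) \<longlonglongrightarrow> 0\<close> order_tendstoD(2) by blast
    then obtain K where K: "\<And>n. n \<ge> K \<Longrightarrow> C * r ^ n / (1 - r) < e"
      by (auto simp: eventually_sequentially)
    have le: "norm (d (u n) (u m)) < e" if "n \<ge> K" "n \<le> m" for n m
      using tail[of n "m - n"] K[OF that(1)] that(2) by simp
    show "\<exists>N. \<forall>n\<ge>N. \<forall>m\<ge>N. norm (d (u n) (u m)) < e"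
    proof (intro exI allI impI)
      fix n m
      assume "n \<ge> K" "m \<ge> K"
      then show "norm (d (u n) (u m)) < e"
        using le[of n m] le[of m n] metric_commute[of "u n" "u m"] by (cases "n \<le> m") auto
    qed
  qed
qed

end

lemma control_function_tendsto:
  assumes F: "F \<in> \<F>"
    and "\<And>n. x n \<in> \<A>\<^sub>+" "\<And>n. y n \<in> \<A>\<^sub>+" "\<And>n. z n \<in> \<A>\<^sub>+"
    and "x0 \<in> \<A>\<^sub>+" "y0 \<in> \<A>\<^sub>+" "z0 \<in> \<A>\<^sub>+"
    and "x \<longlonglongrightarrow> x0" "y \<longlonglongrightarrow> y0" "z \<longlonglongrightarrow> z0"
  shows "(\<lambda>n. F (x n) (y n) (z n)) \<longlonglongrightarrow> F x0 y0 z0"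
proof -
  have "continuous_on (\<A>\<^sub>+ \<times> \<A>\<^sub>+ \<times> \<A>\<^sub>+) (\<lambda>(x, y, z). F x y z)"
    using F by (simp add: control_functions_def)
  moreover have "(\<lambda>n. (x n, y n, z n)) \<longlonglongrightarrow> (x0, y0, z0)"
    using assms(8-10) by (intro tendsto_Pair)
  ultimately have "(\<lambda>n. (\<lambda>(x, y, z). F x y z) (x n, y n, z n)) \<longlonglongrightarrow> (\<lambda>(x, y, z). F x y z) (x0, y0, z0)"
    by (rule continuous_on_tendsto_compose) (use assms in auto)
  then show ?thesis by simp
qed

section \<open>The fixed point theorem\<close>

theorem theorem3p17:
  fixes d :: "'x \<Rightarrow> 'x \<Rightarrow> 'a::unital_cstar_algebra"
    and \<phi> :: "'x \<Rightarrow> 'a"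
    and F :: "'a \<Rightarrow> 'a \<Rightarrow> 'a \<Rightarrow> 'a"
    and T :: "'x \<Rightarrow> 'x"
    and \<alpha> \<beta> \<gamma> :: real
  assumes "cstar_metric d"
    and "cstar_complete d"
    and "\<And>x. \<phi> x \<in> \<A>\<^sub>+"
    and "F \<in> \<F>"
    and "lower_semicontinuous d \<phi>"
    and "0 \<le> \<alpha>" and "0 \<le> \<beta>" and "0 \<le> \<gamma>" and "\<alpha> + \<beta> + \<gamma> < 1"
    and "\<And>x y. F (d (T x) (T y)) (\<phi> (T x)) (\<phi> (T y)) \<preceq>
           \<alpha> *\<^sub>R F (d x y) (\<phi> x) (\<phi> y)
         + \<beta> *\<^sub>R F (d x (T x)) (\<phi> x) (\<phi> (T x))
         + \<gamma> *\<^sub>R F (d y (T y)) (\<phi> y) (\<phi> (T y))"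
  shows "fixed_points T \<subseteq> zero_set \<phi> \<and> phi_Picard d \<phi> T"
proof -
  note dpos = metric_positive[OF assms(1)]
  note d0 = metric_eq_0_iff[OF assms(1)]
  define M where "M x y = F (d x y) (\<phi> x) (\<phi> y)" for x y
  define N where "N x y = norm (M x y)" for x y
  have N0: "0 \<le> N x y" for x y by (simp add: N_def)
  have Fdom: "F a b c \<in> \<A>\<^sub>+ \<and> a \<preceq> F a b c \<and> b \<preceq> F a b c" if "a \<in> \<A>\<^sub>+" "b \<in> \<A>\<^sub>+" "c \<in> \<A>\<^sub>+" for a b c
    using assms(4) that by (simp add: control_functions_def)
  have Mpos: "M x y \<in> \<A>\<^sub>+" for x y using Fdom dpos assms(3) by (simp add: M_def)
  have dN: "norm (d x y) \<le> N x y" and phiN: "norm (\<phi> x) \<le> N x y" for x y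
    unfolding M_def N_def
    by (rule norm_mono_cstar_le[OF dpos], simp add: Fdom dpos assms(3),
        rule norm_mono_cstar_le[OF assms(3)], simp add: Fdom dpos assms(3))
  have contr: "N (T x) (T y) \<le> \<alpha> * N x y + \<beta> * N x (T x) + \<gamma> * N y (T y)" for x y
  proof -
    have "N (T x) (T y) \<le> norm (\<alpha> *\<^sub>R M x y + \<beta> *\<^sub>R M x (T x) + \<gamma> *\<^sub>R M y (T y))"
      unfolding N_def by (rule norm_mono_cstar_le[OF Mpos]) (use assms(10) in \<open>simp add: M_def\<close>)
    also have "\<dots> \<le> norm (\<alpha> *\<^sub>R M x y) + norm (\<beta> *\<^sub>R M x (T x)) + norm (\<gamma> *\<^sub>R M y (T y))"
      by (intro order_trans[OF norm_triangle_ineq] add_right_mono norm_triangle_ineq)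
    also have "\<dots> = \<alpha> * N x y + \<beta> * N x (T x) + \<gamma> * N y (T y)"
      using assms(6-8) by (simp add: N_def)
    finally show ?thesis .
  qed
  have scalar_zero: "a = 0" if "a \<le> c * a" "0 \<le> a" "c < 1" for a c :: real
    using that by (metis antisym_conv2 linorder_not_le mult_le_cancel_right1)
  have N_fixed: "N z z = 0" if "T z = z" for z
  proof -
    have "N z z \<le> (\<alpha> + \<beta> + \<gamma>) * N z z" using contr[of z z] that by (simp add: distrib_right)
    then show ?thesis using scalar_zero N0 assms(9) by blast
  qed
  have phi_fixed: "\<phi> z = 0" if "T z = z" for z
    using phiN[of z z] N_fixed[OF that] by simp
  have unique: "z = w" if "T z = z" "T w = w" for z w
  proof -
    have "N z w \<le> \<alpha> * N z w" using contr[of z w] that N_fixed by simp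
    then have "N z w = 0" using scalar_zero[of _ \<alpha>] N0 assms(6-9) by simp
    then show ?thesis using dN[of z w] d0 by simp
  qed
  have limit: "\<exists>z. T z = z \<and> cstar_converges d (\<lambda>n. (T ^^ n) x) z" for x
  proof -
    define u where "u n = (T ^^ n) x" for n
    have uS: "u (Suc n) = T (u n)" for n by (simp add: u_def)
    \<comment> \<open>The contraction inequality for \<open>u n\<close> and \<open>u (n + 1)\<close> has \<open>N (u (n + 1)) (u (n + 2))\<close> on both
      sides; solving for it gives this ratio.\<close>
    define r where "r = (\<alpha> + \<beta>) / (1 - \<gamma>)"
    have g1: "\<gamma> < 1" using assms(6-9) by linarith
    have r: "0 \<le> r" "r < 1" using assms(6-9) g1 by (simp_all add: r_def field_simps)
    have step: "N (u (Suc n)) (u (Suc (Suc n))) \<le> r * N (u n) (u (Suc n))" for n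
      using contr[of "u n" "u (Suc n)"] g1 by (simp add: uS r_def field_simps)
    have geo: "N (u n) (u (Suc n)) \<le> N x (T x) * r ^ n" for n
    proof (induction n)
      case 0
      show ?case by (simp add: u_def)
    next
      case (Suc n)
      have "r * N (u n) (u (Suc n)) \<le> r * (N x (T x) * r ^ n)"
        using Suc r by (intro mult_left_mono) auto
      then show ?case using step[of n] by (simp add: mult_ac)
    qed
    have N_lim: "(\<lambda>n. N (u n) (u (Suc n))) \<longlonglongrightarrow> 0"
    proof (rule tendsto_sandwich[OF _ _ tendsto_const])
      show "(\<lambda>n. N x (T x) * r ^ n) \<longlonglongrightarrow> 0"
        using r by (auto intro!: tendsto_mult_right_zero LIMSEQ_power_zero)
    qed (use N0 geo in auto)
    have "cstar_Cauchy d u"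
      using Cauchy_if_geometric_steps[OF assms(1) r] dN geo order_trans by blast
    then obtain z where z: "cstar_converges d u z" using assms(2) by (auto simp: cstar_complete_def)
    have phi_norm: "(\<lambda>n. norm (\<phi> (u n))) \<longlonglongrightarrow> 0"
      by (rule tendsto_sandwich[OF _ _ tendsto_const N_lim]) (use phiN in auto)
    then have phi_lim: "(\<lambda>n. \<phi> (u n)) \<longlonglongrightarrow> 0" by (rule tendsto_norm_zero_cancel)
    have "liminf (\<lambda>n. ereal (norm (\<phi> (u n)))) = ereal 0"
      using phi_norm by (intro lim_imp_Liminf) auto
    then have phiz: "\<phi> z = 0"
      using assms(5) z by (fastforce simp: lower_semicontinuous_def)
    have zero_pos: "(0::'a) \<in> \<A>\<^sub>+" using assms(3)[of z] phiz by simp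
    have "(\<lambda>n. d (u n) z) \<longlonglongrightarrow> 0"
      using z tendsto_norm_zero_cancel by (auto simp: cstar_converges_def)
    then have "(\<lambda>n. M (u n) z) \<longlonglongrightarrow> F 0 0 0"
      unfolding M_def phiz
      by (intro control_function_tendsto[OF assms(4)] phi_lim tendsto_const dpos assms(3) zero_pos)
    then have lim1: "(\<lambda>n. N (u n) z) \<longlonglongrightarrow> 0"
      unfolding N_def using assms(4) by (auto simp: control_functions_def intro: tendsto_norm_zero)
    have "(\<lambda>n. M (u n) (T z)) \<longlonglongrightarrow> F (d z (T z)) 0 (\<phi> (T z))"
      unfolding M_def
      by (intro control_function_tendsto[OF assms(4)] phi_lim tendsto_const dpos assms(3) zero_pos
          metric_tendsto[OF assms(1)] z)
    then have "(\<lambda>n. M (u n) (T z)) \<longlonglongrightarrow> M z (T z)" by (simp add: M_def phiz)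
    then have "(\<lambda>n. N (u n) (T z)) \<longlonglongrightarrow> N z (T z)" unfolding N_def by (rule tendsto_norm)
    then have lim2: "(\<lambda>n. N (u (Suc n)) (T z)) \<longlonglongrightarrow> N z (T z)" by (rule LIMSEQ_Suc)
    have "(\<lambda>n. \<alpha> * N (u n) z + \<beta> * N (u n) (u (Suc n)) + \<gamma> * N z (T z))
        \<longlonglongrightarrow> \<alpha> * 0 + \<beta> * 0 + \<gamma> * N z (T z)"
      by (intro tendsto_intros lim1 N_lim)
    then have "N z (T z) \<le> \<alpha> * 0 + \<beta> * 0 + \<gamma> * N z (T z)"
      by (rule LIMSEQ_le[OF lim2]) (use contr[of _ z] uS in auto)
    then have "N z (T z) = 0" using scalar_zero[of _ \<gamma>] N0 g1 by simp
    then have "T z = z" using dN[of z "T z"] d0[of z "T z"] by simp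
    then show ?thesis using z unfolding u_def by blast
  qed
  obtain z where z: "T z = z" using limit by blast
  have "fixed_points T \<inter> zero_set \<phi> = {z}"
    using z phi_fixed unique by (auto simp: fixed_points_def zero_set_def)
  moreover have "cstar_converges d (\<lambda>n. (T ^^ n) x) z" for x
    using limit[of x] unique z by metis
  ultimately have "phi_Picard d \<phi> T" by (auto simp: phi_Picard_def)
  then show ?thesis using phi_fixed by (auto simp: fixed_points_def zero_set_def)
qed

end
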